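(* Let $f_1,\dots,f_m:\mathbb{R}^{n_1\times n_2}\to\mathbb{R}$ be convex and lower semi-continuous functions, and suppose that $\mathcal{C}=\{X\in\mathbb{R}^{n_1\times n_2} : f_i(X)\le 0,\ i=1,\dots,m\}$ is nonempty. For each $\tau>0$ let $X_\tau^\star$ be the solution to $$\text{minimize } \ \tau\|X\|_*+\tfrac12\|X\|_F^2 \quad \text{subject to } f_i(X)\le 0,\ i=1,\dots,m,$$ and let $X_\infty$ be the minimum Frobenius-norm solution of the problem $$\text{minimize } \ \|X\|_* \quad \text{subject to } f_i(X)\le 0,\ i=1,\dots,m,$$ that is, $X_\infty := \arg\min_X\{\|X\|_F^2 : X \text{ is a solution of this latter problem}\}$. Then $$\lim_{\tau\to\infty}\|X_\tau^\star - X_\infty\|_F = 0.$$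
   Context: For a matrix $X\in\mathbb{R}^{n_1\times n_2}$, $\|X\|_*$ denotes the nuclear norm (the sum of the singular values) and $\|X\|_F$ the Frobenius norm. *)

theory Defs
  imports "HOL-Analysis.Analysis"
begin

definition lower_semicontinuous :: "('a::topological_space \<Rightarrow> real) \<Rightarrow> bool" where
  "lower_semicontinuous f \<longleftrightarrow> (\<forall>x c. c < f x \<longrightarrow> (\<forall>\<^sub>F y in nhds x. c < f y))"

text \<open>A singular value of \<open>X\<close> is the square root of an eigenvalue of the Gram matrix
  \<open>X\<^sup>T X\<close>. This matrix is symmetric, so the algebraic multiplicity of an eigenvalue is the
  dimension of its eigenspace.\<close>

definition gram_eigenspace :: "real^'n2^'n1 \<Rightarrow> real \<Rightarrow> (real^'n2) set" where
  "gram_eigenspace X \<mu> = {v. (transpose X ** X) *v v = \<mu> *\<^sub>R v}"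

definition singular_values :: "real^'n2^'n1 \<Rightarrow> real set" where
  "singular_values X = {\<sigma>. 0 \<le> \<sigma> \<and> (\<exists>v\<in>gram_eigenspace X (\<sigma>\<^sup>2). v \<noteq> 0)}"

definition singular_value_multiplicity :: "real^'n2^'n1 \<Rightarrow> real \<Rightarrow> nat" where
  "singular_value_multiplicity X \<sigma> = dim (gram_eigenspace X (\<sigma>\<^sup>2))"

text \<open>For an \<open>n1 \<times> n2\<close> matrix with \<open>n2 > n1\<close>, \<open>singular_values\<close> also contains the surplus zeros;
  they do not contribute to the sum.\<close>

definition nuclear_norm :: "real^'n2^'n1 \<Rightarrow> real" where
  "nuclear_norm X = (\<Sum>\<sigma>\<in>singular_values X. real (singular_value_multiplicity X \<sigma>) * \<sigma>)"

lemma finite_singular_values: "finite (singular_values (X :: real^'n2^'n1))"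
proof -
  define A where "A = transpose X ** X"
  have sym: "(A *v v) \<bullet> w = v \<bullet> (A *v w)" for v w
  proof -
    have "transpose A = A"
      by (simp add: A_def matrix_transpose_mul)
    thus ?thesis
      by (metis dot_lmul_matrix vector_transpose_matrix)
  qed
  have "\<forall>s\<in>singular_values X. \<exists>v. A *v v = s\<^sup>2 *\<^sub>R v \<and> v \<noteq> 0 \<and> 0 \<le> s"
    by (auto simp: singular_values_def gram_eigenspace_def A_def)
  then obtain e where e: "\<forall>s\<in>singular_values X. A *v e s = s\<^sup>2 *\<^sub>R e s \<and> e s \<noteq> 0 \<and> 0 \<le> s"
    by (rule bchoice [THEN exE])
  have orth: "e s \<bullet> e t = 0"
    if s: "s \<in> singular_values X" and t: "t \<in> singular_values X" and st: "s \<noteq> t" for s t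
  proof -
    have "s\<^sup>2 * (e s \<bullet> e t) = t\<^sup>2 * (e s \<bullet> e t)"
      using sym [of "e s" "e t"] e s t by simp
    moreover have "s\<^sup>2 \<noteq> t\<^sup>2"
      using e s t st by simp
    ultimately show ?thesis by simp
  qed
  have "pairwise orthogonal (e ` singular_values X)"
    using orth by (force simp: pairwise_def orthogonal_def)
  hence "finite (e ` singular_values X)"
    by (rule pairwise_orthogonal_imp_finite)
  moreover have "inj_on e (singular_values X)"
  proof (rule inj_onI, rule ccontr)
    fix s t assume "s \<in> singular_values X" "t \<in> singular_values X" "e s = e t" "s \<noteq> t"
    with orth [of s t] e show False by simp
  qed
  ultimately show ?thesis
    by (rule finite_imageD)
qed

lemma norm_matrix_eq_Frobenius:
  "norm (X :: real^'n2^'n1) = sqrt (\<Sum>i\<in>UNIV. \<Sum>j\<in>UNIV. (X $ i $ j)\<^sup>2)"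
  by (simp add: norm_vec_def L2_set_def sum_nonneg)

definition feasible :: "nat \<Rightarrow> (nat \<Rightarrow> real^'n2^'n1 \<Rightarrow> real) \<Rightarrow> (real^'n2^'n1) set" where
  "feasible m f = {X. \<forall>i\<in>{1..m}. f i X \<le> 0}"

definition prox_objective :: "real \<Rightarrow> real^'n2^'n1 \<Rightarrow> real" where
  "prox_objective \<tau> X = \<tau> * nuclear_norm X + 1/2 * (norm X)\<^sup>2"

definition nuclear_solution :: "nat \<Rightarrow> (nat \<Rightarrow> real^'n2^'n1 \<Rightarrow> real) \<Rightarrow> real^'n2^'n1 \<Rightarrow> bool" where
  "nuclear_solution m f X \<longleftrightarrow> is_arg_min nuclear_norm (\<lambda>Y. Y \<in> feasible m f) X"

end

theory Submission
  imports Defs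
begin

text \<open>The statement is about a convex function \<open>g\<close> (the nuclear norm), minimised over a closed
  convex set \<open>S\<close> and regularised by the squared norm with the small weight \<open>1/(2 \<tau>)\<close>.

  Comparing values at \<open>X\<^sub>\<tau>\<close> and \<open>X\<^sub>\<infinity>\<close> gives
  \<open>\<tau> (g X\<^sub>\<tau> - g X\<^sub>\<infinity>) \<le> 1/2 (\<parallel>X\<^sub>\<infinity>\<parallel>\<^sup>2 - \<parallel>X\<^sub>\<tau>\<parallel>\<^sup>2)\<close>. The left-hand side is nonnegative, so
  \<open>\<parallel>X\<^sub>\<tau>\<parallel> \<le> \<parallel>X\<^sub>\<infinity>\<parallel>\<close> for every \<open>\<tau>\<close>, and \<open>g X\<^sub>\<tau>\<close> tends to the minimum of \<open>g\<close>. The points of \<open>S\<close> of norm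
  at most \<open>\<parallel>X\<^sub>\<infinity>\<parallel>\<close> and at distance at least \<open>\<epsilon>\<close> from \<open>X\<^sub>\<infinity>\<close> form a compact set. No minimiser of \<open>g\<close>
  lies in it, because \<open>X\<^sub>\<infinity>\<close> is the only minimiser of \<open>g\<close> with so small a norm. Hence \<open>g\<close> exceeds its
  minimum by a fixed amount on that set, and \<open>X\<^sub>\<tau>\<close> leaves it once \<open>\<tau>\<close> is large
  (\<open>tendsto_regularized_minimizer\<close>). Existence and uniqueness of the minimisers come from coercivity
  and from the strict convexity of the squared norm (\<open>ex1_arg_min_regularized\<close>).

  The nuclear norm is defined through the eigenvalues of \<open>X\<^sup>T X\<close>, so its convexity is the main
  work. By the spectral theorem there is an orthonormal basis \<open>B\<close> of eigenvectors of \<open>X\<^sup>T X\<close>; the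
  vectors \<open>X b\<close> are orthogonal, their lengths are the singular values, and the nuclear norm is
  \<open>\<Sum>b\<in>B. \<parallel>X b\<parallel>\<close>. The linear functional \<open>Y \<mapsto> \<Sum>b\<in>B. sgn (X b) \<bullet> Y b\<close> then equals the nuclear
  norm at \<open>X\<close>, and by Bessel's inequality it is at most the nuclear norm everywhere. A function with
  such a supporting functional at each point is convex, hence continuous
  (\<open>nuclear_norm_supporting_functional\<close>). Coercivity is the inequality
  \<open>norm_le_nuclear_norm\<close>.\<close>

section \<open>The spectral theorem for self-adjoint maps\<close>

text \<open>The maximiser of the Rayleigh quotient is an eigenvector. With \<open>\<mu>\<close> the maximum, the quadratic
  form \<open>\<mu> \<parallel>x\<parallel>\<^sup>2 - x \<bullet> A x\<close> is nonnegative on \<open>K\<close> and vanishes at the maximiser \<open>v\<close>, so its first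
  variation at \<open>v\<close> vanishes in the direction \<open>\<mu> v - A v\<close>, which lies in \<open>K\<close>.\<close>

lemma self_adjoint_eigenvector_in_invariant_subspace:
  fixes A :: "'a::euclidean_space \<Rightarrow> 'a"
  assumes lin: "linear A" and sym: "\<And>x y. A x \<bullet> y = x \<bullet> A y"
    and K: "subspace K" "K \<noteq> {0}" and inv: "\<And>x. x \<in> K \<Longrightarrow> A x \<in> K"
  obtains v \<mu> where "v \<in> K" "v \<noteq> 0" "A v = \<mu> *\<^sub>R v"
proof -
  let ?S = "sphere 0 1 \<inter> K"
  have "compact ?S"
    by (simp add: compact_Int_closed closed_subspace K)
  moreover have "?S \<noteq> {}"
  proof -
    obtain x where "x \<in> K" "x \<noteq> 0"
      using K subspace_0 by blast
    then have "sgn x \<in> ?S"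
      by (simp add: sgn_div_norm K subspace_scale)
    then show ?thesis by blast
  qed
  moreover have "continuous_on ?S (\<lambda>x. x \<bullet> A x)"
    by (intro continuous_intros linear_continuous_on linear_linear[THEN iffD2] lin)
  ultimately obtain v where v: "v \<in> ?S" and vmax: "\<And>x. x \<in> ?S \<Longrightarrow> x \<bullet> A x \<le> v \<bullet> A v"
    using continuous_attains_sup by metis
  define \<mu> where "\<mu> = v \<bullet> A v"
  have vK: "v \<in> K" and v1: "v \<bullet> v = 1"
    using v by (auto simp: dot_square_norm)
  have nonneg: "0 \<le> \<mu> * (x \<bullet> x) - x \<bullet> A x" if "x \<in> K" for x
  proof (cases "x = 0")
    case False
    have "sgn x \<in> ?S"
      using that False by (simp add: sgn_div_norm K subspace_scale)
    from vmax[OF this] have "(x \<bullet> A x) / (x \<bullet> x) \<le> \<mu>"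
      by (simp add: sgn_div_norm linear_scale[OF lin] \<mu>_def dot_square_norm power2_eq_square
          divide_inverse mult_ac)
    then show ?thesis
      using False by (simp add: pos_divide_le_eq)
  qed (simp add: linear_0[OF lin])
  define u where "u = \<mu> *\<^sub>R v - A v"
  define b where "b = u \<bullet> u"
  define Q where "Q = \<mu> * (u \<bullet> u) - u \<bullet> A u"
  have uK: "u \<in> K"
    unfolding u_def by (intro subspace_diff subspace_scale K vK inv)
  have Q0: "0 \<le> Q"
    unfolding Q_def by (rule nonneg[OF uK])
  have quad: "0 \<le> 2 * t * b + t\<^sup>2 * Q" for t
  proof -
    have "v + t *\<^sub>R u \<in> K"
      by (intro subspace_add subspace_scale K vK uK)
    from nonneg[OF this]
    have "0 \<le> \<mu> * (v \<bullet> v) - v \<bullet> A v + 2 * t * (\<mu> * (v \<bullet> u) - A v \<bullet> u) + t\<^sup>2 * Q"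
      using sym[of v u]
      by (simp add: linear_add[OF lin] linear_scale[OF lin] inner_simps Q_def power2_eq_square
          algebra_simps inner_commute)
    moreover have "\<mu> * (v \<bullet> u) - A v \<bullet> u = b"
      using sym[of v v] by (simp add: b_def u_def inner_simps)
    ultimately show ?thesis
      by (simp add: v1 \<mu>_def)
  qed
  have "b = 0"
  proof (rule ccontr)
    assume "b \<noteq> 0"
    then have "0 < b" by (simp add: b_def)
    \<comment> \<open>The step \<open>- b / Q\<close> would minimise the quadratic; \<open>Q + 1\<close> covers the case \<open>Q = 0\<close>.\<close>
    define s where "s = Q + 1"
    have Qs: "Q = s - 1" and "0 < s"
      using Q0 by (simp_all add: s_def)
    then have "2 * (- b / s) * b + (- b / s)\<^sup>2 * Q = - (b\<^sup>2 * (s + 1)) / s\<^sup>2"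
      unfolding Qs by (simp add: field_simps power2_eq_square)
    moreover have "\<dots> < 0"
      using \<open>0 < s\<close> \<open>0 < b\<close> by (intro divide_neg_pos) (auto intro!: mult_pos_pos)
    ultimately show False
      using quad[of "- b / s"] by linarith
  qed
  then have "A v = \<mu> *\<^sub>R v"
    by (simp add: b_def u_def)
  moreover have "v \<noteq> 0" using v1 by auto
  ultimately show ?thesis using that vK by blast
qed

text \<open>The orthogonal complement of the span of all eigenvectors is invariant, so it would contain a
  further eigenvector if it were not zero.\<close>

lemma self_adjoint_span_eigenvectors:
  fixes A :: "'a::euclidean_space \<Rightarrow> 'a"
  assumes lin: "linear A" and sym: "\<And>x y. A x \<bullet> y = x \<bullet> A y"
  shows "span {v. \<exists>\<mu>. A v = \<mu> *\<^sub>R v} = UNIV"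
proof -
  let ?E = "{v. \<exists>\<mu>. A v = \<mu> *\<^sub>R v}"
  let ?K = "(span ?E)\<^sup>\<bottom>"
  have inv: "A x \<in> ?K" if "x \<in> ?K" for x
  proof -
    have "orthogonal (A x) y" if "y \<in> ?E" for y
    proof -
      have "orthogonal x y"
        using \<open>x \<in> ?K\<close> that by (auto simp: orthogonal_comp_def orthogonal_commute span_base)
      then show ?thesis
        using that by (auto simp: orthogonal_def sym)
    qed
    then have "orthogonal (A x) y" if "y \<in> span ?E" for y
      using orthogonal_to_span[OF that] by blast
    then show ?thesis
      by (simp add: orthogonal_comp_def orthogonal_commute)
  qed
  have "?K = {0}"
  proof (rule ccontr)
    assume "?K \<noteq> {0}"
    from self_adjoint_eigenvector_in_invariant_subspace[OF lin sym subspace_orthogonal_comp this inv]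
    obtain v \<mu> where v: "v \<in> ?K" "v \<noteq> 0" "A v = \<mu> *\<^sub>R v" by blast
    then have "v \<in> span ?E" by (auto intro: span_base)
    with v(1) have "v \<bullet> v = 0"
      by (auto simp: orthogonal_comp_def orthogonal_def)
    with v(2) show False by simp
  qed
  then show ?thesis
    using orthogonal_comp_self[OF subspace_span, of ?E] by simp
qed

section \<open>The nuclear norm as a sum over an orthonormal eigenbasis\<close>

lemma inner_gram_matrix:
  fixes X :: "real^'n2^'n1"
  shows "((transpose X ** X) *v v) \<bullet> w = (X *v v) \<bullet> (X *v w)"
  by (simp add: matrix_vector_mul_assoc[symmetric] dot_lmul_matrix)

text \<open>The union of orthonormal bases of the eigenspaces works: distinct eigenspaces of the Gram matrix
  are orthogonal, together they span, and on the \<open>\<sigma>\<^sup>2\<close>-eigenspace a unit vector is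
  stretched by \<open>X\<close> exactly to length \<open>\<sigma>\<close>.\<close>

lemma nuclear_norm_orthonormal_basis:
  fixes X :: "real^'n2^'n1"
  obtains B where "finite B" "pairwise orthogonal B" "\<And>b. b \<in> B \<Longrightarrow> norm b = 1" "span B = UNIV"
    "pairwise (\<lambda>b c. orthogonal (X *v b) (X *v c)) B"
    "nuclear_norm X = (\<Sum>b\<in>B. norm (X *v b))"
proof -
  define A where "A = (\<lambda>v. (transpose X ** X) *v v)"
  have lin: "linear A" unfolding A_def by simp
  have AX: "A v \<bullet> w = (X *v v) \<bullet> (X *v w)" for v w
    unfolding A_def by (rule inner_gram_matrix)
  have sym: "A v \<bullet> w = v \<bullet> A w" for v w
    using AX[of v w] AX[of w v] by (simp add: inner_commute)
  have E: "v \<in> gram_eigenspace X \<mu> \<longleftrightarrow> A v = \<mu> *\<^sub>R v" for v \<mu>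
    by (simp add: gram_eigenspace_def A_def)
  have sub: "subspace (gram_eigenspace X \<mu>)" for \<mu>
    by (auto simp: subspace_def E linear_0[OF lin] linear_add[OF lin] linear_scale[OF lin]
        scaleR_add_right mult.commute)
  have "\<forall>\<sigma>. \<exists>B. B \<subseteq> gram_eigenspace X (\<sigma>\<^sup>2) \<and> pairwise orthogonal B \<and> (\<forall>b\<in>B. norm b = 1) \<and>
      independent B \<and> card B = dim (gram_eigenspace X (\<sigma>\<^sup>2)) \<and> span B = gram_eigenspace X (\<sigma>\<^sup>2)"
  proof
    fix \<sigma> :: real
    show "\<exists>B. B \<subseteq> gram_eigenspace X (\<sigma>\<^sup>2) \<and> pairwise orthogonal B \<and> (\<forall>b\<in>B. norm b = 1) \<and>
      independent B \<and> card B = dim (gram_eigenspace X (\<sigma>\<^sup>2)) \<and> span B = gram_eigenspace X (\<sigma>\<^sup>2)"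
      by (rule orthonormal_basis_subspace[OF sub[of "\<sigma>\<^sup>2"]]) blast
  qed
  then obtain F where FE: "\<And>\<sigma>. F \<sigma> \<subseteq> gram_eigenspace X (\<sigma>\<^sup>2)"
    and Forth: "\<And>\<sigma>. pairwise orthogonal (F \<sigma>)" and F1: "\<And>\<sigma> b. b \<in> F \<sigma> \<Longrightarrow> norm b = 1"
    and Find: "\<And>\<sigma>. independent (F \<sigma>)" and Fcard: "\<And>\<sigma>. card (F \<sigma>) = dim (gram_eigenspace X (\<sigma>\<^sup>2))"
    and Fspan: "\<And>\<sigma>. span (F \<sigma>) = gram_eigenspace X (\<sigma>\<^sup>2)"
    by (rule choice[THEN exE]) blast
  let ?S = "singular_values X"
  define B where "B = (\<Union>\<sigma>\<in>?S. F \<sigma>)"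
  have Ffin: "finite (F \<sigma>)" for \<sigma>
    using Find independent_imp_finite by blast
  have AF: "A b = \<sigma>\<^sup>2 *\<^sub>R b" if "b \<in> F \<sigma>" for b \<sigma>
    using FE that E by blast
  have XF: "norm (X *v b) = \<sigma>" if "b \<in> F \<sigma>" "\<sigma> \<in> ?S" for b \<sigma>
  proof -
    have "(norm (X *v b))\<^sup>2 = A b \<bullet> b"
      by (simp add: AX dot_square_norm)
    also have "\<dots> = \<sigma>\<^sup>2"
      using AF[OF that(1)] F1[OF that(1)] by (simp add: dot_square_norm)
    finally show ?thesis
      using that(2) by (auto simp: singular_values_def)
  qed
  have Borth: "orthogonal b c" if bc: "b \<in> B" "c \<in> B" "b \<noteq> c" for b c
  proof -
    obtain \<sigma> \<tau> where st: "\<sigma> \<in> ?S" "b \<in> F \<sigma>" "\<tau> \<in> ?S" "c \<in> F \<tau>"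
      using bc by (auto simp: B_def)
    show ?thesis
    proof (cases "\<sigma> = \<tau>")
      case True
      then show ?thesis
        using st bc(3) Forth by (auto simp: pairwise_def)
    next
      case False
      have "\<sigma>\<^sup>2 * (b \<bullet> c) = \<tau>\<^sup>2 * (b \<bullet> c)"
        using sym[of b c] AF st by simp
      moreover have "\<sigma>\<^sup>2 \<noteq> \<tau>\<^sup>2"
        using False st by (auto simp: singular_values_def)
      ultimately show ?thesis by (simp add: orthogonal_def)
    qed
  qed
  have "v \<in> span B" if "A v = \<mu> *\<^sub>R v" for v \<mu>
  proof (cases "v = 0")
    case False
    have "\<mu> * (v \<bullet> v) = (X *v v) \<bullet> (X *v v)"
      using AX[of v v] that by simp
    then have "0 \<le> \<mu> * (v \<bullet> v)" by simp
    then have "0 \<le> \<mu>"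
      using False by (metis inner_gt_zero_iff zero_le_mult_iff not_less)
    then have "sqrt \<mu> \<in> ?S" "v \<in> gram_eigenspace X ((sqrt \<mu>)\<^sup>2)"
      using that False E by (auto simp: singular_values_def)
    then have "v \<in> span (F (sqrt \<mu>))" "F (sqrt \<mu>) \<subseteq> B"
      using Fspan by (auto simp: B_def)
    then show ?thesis using span_mono by blast
  qed (simp add: span_0)
  then have "{v. \<exists>\<mu>. A v = \<mu> *\<^sub>R v} \<subseteq> span B" by blast
  then have "span {v. \<exists>\<mu>. A v = \<mu> *\<^sub>R v} \<subseteq> span B"
    by (rule span_minimal) (rule subspace_span)
  then have span: "span B = UNIV"
    using self_adjoint_span_eigenvectors[OF lin sym] by auto
  have "orthogonal (X *v b) (X *v c)" if bc: "b \<in> B" "c \<in> B" "b \<noteq> c" for b c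
  proof -
    obtain \<sigma> where "A b = \<sigma>\<^sup>2 *\<^sub>R b"
      using bc AF by (auto simp: B_def)
    then show ?thesis
      using AX[of b c] Borth[OF bc] by (simp add: orthogonal_def)
  qed
  moreover have "nuclear_norm X = (\<Sum>b\<in>B. norm (X *v b))"
  proof -
    have "(\<Sum>b\<in>B. norm (X *v b)) = (\<Sum>\<sigma>\<in>?S. \<Sum>b\<in>F \<sigma>. norm (X *v b))"
      unfolding B_def
    proof (rule sum.UNION_disjoint)
      show "\<forall>\<sigma>\<in>?S. \<forall>\<tau>\<in>?S. \<sigma> \<noteq> \<tau> \<longrightarrow> F \<sigma> \<inter> F \<tau> = {}"
        using XF by blast
    qed (simp_all add: Ffin finite_singular_values)
    also have "\<dots> = (\<Sum>\<sigma>\<in>?S. real (card (F \<sigma>)) * \<sigma>)"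
      by (simp add: XF)
    finally show ?thesis
      by (simp add: nuclear_norm_def singular_value_multiplicity_def Fcard)
  qed
  moreover have "finite B"
    by (simp add: B_def Ffin finite_singular_values)
  moreover have "pairwise orthogonal B"
    using Borth by (simp add: pairwise_def)
  ultimately show ?thesis
    using span F1 by (intro that[of B]) (auto simp: pairwise_def B_def)
qed

section \<open>Convexity and coercivity of the nuclear norm\<close>

lemma Bessel_inequality:
  fixes u :: "'i \<Rightarrow> 'a::real_inner"
  assumes "finite I" and orth: "pairwise (\<lambda>i j. orthogonal (u i) (u j)) I"
    and le1: "\<And>i. i \<in> I \<Longrightarrow> norm (u i) \<le> 1"
  shows "(\<Sum>i\<in>I. (u i \<bullet> w)\<^sup>2) \<le> (norm w)\<^sup>2"
proof -
  define p where "p = (\<Sum>i\<in>I. (u i \<bullet> w) *\<^sub>R u i)"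
  have "(norm p)\<^sup>2 = (\<Sum>i\<in>I. (u i \<bullet> w)\<^sup>2 * (norm (u i))\<^sup>2)"
    unfolding p_def
    by (subst norm_sum_Pythagorean)
      (use assms in \<open>auto simp: pairwise_def orthogonal_def power_mult_distrib\<close>)
  also have "\<dots> \<le> (\<Sum>i\<in>I. (u i \<bullet> w)\<^sup>2)"
    using le1 by (intro sum_mono mult_left_le) (auto simp: power_le_one)
  finally have "(norm p)\<^sup>2 \<le> (\<Sum>i\<in>I. (u i \<bullet> w)\<^sup>2)" .
  moreover have "w \<bullet> p = (\<Sum>i\<in>I. (u i \<bullet> w)\<^sup>2)"
    by (simp add: p_def inner_sum_right power2_eq_square inner_commute)
  moreover have "0 \<le> (norm w)\<^sup>2 - 2 * (w \<bullet> p) + (norm p)\<^sup>2"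
    using zero_le_power2[of "norm (w - p)"]
    by (simp add: power2_norm_eq_inner inner_simps inner_commute)
  ultimately show ?thesis by linarith
qed

text \<open>The functional is \<open>Y \<mapsto> \<Sum>b\<in>B. sgn (X b) \<bullet> Y b\<close>, the pairing of \<open>Y\<close> with the polar factor of
  \<open>X\<close>. Expanding each \<open>b\<close> in an eigenbasis \<open>C\<close> belonging to \<open>Y\<close> turns it into
  \<open>\<Sum>c\<in>C. \<parallel>Y c\<parallel> * (\<Sum>b\<in>B. (b \<bullet> c) * (sgn (X b) \<bullet> sgn (Y c)))\<close>. By Bessel's inequality, applied to
  the families \<open>b\<close> and \<open>sgn (X b)\<close>, each inner sum is at most \<open>1\<close>.\<close>

lemma nuclear_norm_supporting_functional:
  fixes X :: "real^'n2^'n1"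
  obtains L :: "real^'n2^'n1 \<Rightarrow> real"
  where "linear L" "L X = nuclear_norm X" "\<And>Y. L Y \<le> nuclear_norm Y"
proof -
  obtain B where B: "finite B" "pairwise orthogonal B" "\<And>b. b \<in> B \<Longrightarrow> norm b = 1"
    and BX: "pairwise (\<lambda>b c. orthogonal (X *v b) (X *v c)) B"
    and nX: "nuclear_norm X = (\<Sum>b\<in>B. norm (X *v b))"
    by (rule nuclear_norm_orthonormal_basis[of X]) blast
  have sgn_inner: "sgn v \<bullet> v = norm v" for v :: "real^'n1"
    by (cases "v = 0") (simp_all add: sgn_div_norm dot_square_norm power2_eq_square)
  define L where "L = (\<lambda>Y. \<Sum>b\<in>B. sgn (X *v b) \<bullet> (Y *v b))"
  have "linear L"
    unfolding L_def
    by (intro linear_compose_sum ballI linearI)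
      (auto simp: matrix_vector_mult_add_rdistrib inner_simps scaleR_matrix_vector_assoc[symmetric])
  moreover have "L X = nuclear_norm X"
    unfolding L_def nX
    by (intro sum.cong refl sgn_inner)
  moreover have "L Y \<le> nuclear_norm Y" for Y
  proof -
    obtain C where C: "finite C" "pairwise orthogonal C" "\<And>c. c \<in> C \<Longrightarrow> norm c = 1" "span C = UNIV"
      and nY: "nuclear_norm Y = (\<Sum>c\<in>C. norm (Y *v c))"
      by (rule nuclear_norm_orthonormal_basis[of Y]) blast
    have Yb: "Y *v b = (\<Sum>c\<in>C. (b \<bullet> c) *\<^sub>R (Y *v c))" for b
    proof -
      have "Y *v b = Y *v (\<Sum>c\<in>C. (b \<bullet> c) *\<^sub>R c)"
        using orthonormal_basis_expand[of C b] C by simp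
      then show ?thesis
        by (simp add: linear_sum[OF matrix_vector_mul_linear] linear_scale[OF matrix_vector_mul_linear])
    qed
    have inner_le: "(\<Sum>b\<in>B. (b \<bullet> c) * (sgn (X *v b) \<bullet> w)) \<le> 1"
      if "norm c = 1" "norm w \<le> 1" for c w
    proof -
      have "(\<Sum>b\<in>B. (b \<bullet> c)\<^sup>2) \<le> (norm c)\<^sup>2"
        using B by (intro Bessel_inequality) (auto simp: pairwise_def)
      then have 1: "(\<Sum>b\<in>B. (b \<bullet> c)\<^sup>2) \<le> 1"
        using that by simp
      have "(\<Sum>b\<in>B. (sgn (X *v b) \<bullet> w)\<^sup>2) \<le> (norm w)\<^sup>2"
      proof (rule Bessel_inequality[OF B(1)])
        show "pairwise (\<lambda>b c. orthogonal (sgn (X *v b)) (sgn (X *v c))) B"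
          using BX by (simp add: pairwise_def orthogonal_def sgn_div_norm)
      qed (simp add: norm_sgn)
      also have "\<dots> \<le> 1"
        using that by (simp add: power_le_one)
      finally have 2: "(\<Sum>b\<in>B. (sgn (X *v b) \<bullet> w)\<^sup>2) \<le> 1" .
      have "(\<Sum>b\<in>B. (b \<bullet> c) * (sgn (X *v b) \<bullet> w))
          \<le> (\<Sum>b\<in>B. ((b \<bullet> c)\<^sup>2 + (sgn (X *v b) \<bullet> w)\<^sup>2) / 2)"
      proof (rule sum_mono)
        fix b
        show "(b \<bullet> c) * (sgn (X *v b) \<bullet> w) \<le> ((b \<bullet> c)\<^sup>2 + (sgn (X *v b) \<bullet> w)\<^sup>2) / 2"
          using sum_squares_bound[of "b \<bullet> c" "sgn (X *v b) \<bullet> w"] by simp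
      qed
      also have "\<dots> = ((\<Sum>b\<in>B. (b \<bullet> c)\<^sup>2) + (\<Sum>b\<in>B. (sgn (X *v b) \<bullet> w)\<^sup>2)) / 2"
        by (simp add: sum.distrib sum_divide_distrib[symmetric])
      finally show ?thesis using 1 2 by simp
    qed
    have polar: "u \<bullet> x = norm x * (u \<bullet> sgn x)" for u x :: "real^'n1"
      by (cases "x = 0") (simp_all add: sgn_div_norm)
    have "L Y = (\<Sum>b\<in>B. \<Sum>c\<in>C. (b \<bullet> c) * (sgn (X *v b) \<bullet> (Y *v c)))"
      unfolding L_def
    proof (intro sum.cong refl)
      fix b
      show "sgn (X *v b) \<bullet> (Y *v b) = (\<Sum>c\<in>C. (b \<bullet> c) * (sgn (X *v b) \<bullet> (Y *v c)))"
        by (simp add: Yb[of b] inner_sum_right)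
    qed
    also have "\<dots> = (\<Sum>c\<in>C. \<Sum>b\<in>B. (b \<bullet> c) * (sgn (X *v b) \<bullet> (Y *v c)))"
      by (rule sum.swap)
    also have "\<dots> = (\<Sum>c\<in>C. norm (Y *v c) * (\<Sum>b\<in>B. (b \<bullet> c) * (sgn (X *v b) \<bullet> sgn (Y *v c))))"
      by (simp add: polar[of _ "Y *v _"] sum_distrib_left mult_ac)
    also have "\<dots> \<le> (\<Sum>c\<in>C. norm (Y *v c) * 1)"
      by (intro sum_mono mult_left_mono inner_le) (auto simp: C norm_sgn)
    finally show ?thesis by (simp add: nY)
  qed
  ultimately show ?thesis by (rule that)
qed

lemma convex_on_nuclear_norm: "convex_on UNIV (nuclear_norm :: real^'n2^'n1 \<Rightarrow> real)"
proof (rule convex_onI)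
  fix t :: real and X Y :: "real^'n2^'n1"
  assume t: "0 < t" "t < 1"
  let ?Z = "(1 - t) *\<^sub>R X + t *\<^sub>R Y"
  obtain L :: "real^'n2^'n1 \<Rightarrow> real"
    where L: "linear L" "L ?Z = nuclear_norm ?Z" "\<And>Y. L Y \<le> nuclear_norm Y"
    by (rule nuclear_norm_supporting_functional[of ?Z]) blast
  have "nuclear_norm ?Z = (1 - t) * L X + t * L Y"
    by (simp add: L(2)[symmetric] linear_add[OF L(1)] linear_scale[OF L(1)])
  also have "\<dots> \<le> (1 - t) * nuclear_norm X + t * nuclear_norm Y"
    using t L(3) by (intro add_mono mult_left_mono) auto
  finally show "nuclear_norm ?Z \<le> (1 - t) * nuclear_norm X + t * nuclear_norm Y" .
qed simp

lemma continuous_on_nuclear_norm: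
  "continuous_on UNIV (nuclear_norm :: real^'n2^'n1 \<Rightarrow> real)"
  by (rule convex_on_continuous[OF open_UNIV convex_on_nuclear_norm])

text \<open>The squared Frobenius norm is the sum of the squared singular values, by Parseval's identity for
  the rows of \<open>X\<close> in the eigenbasis, and the \<open>\<ell>\<^sub>2\<close> norm of a finite family is at most its
  \<open>\<ell>\<^sub>1\<close> norm.\<close>

lemma norm_le_nuclear_norm: "norm X \<le> nuclear_norm (X :: real^'n2^'n1)"
proof -
  obtain B where B: "finite B" "pairwise orthogonal B" "\<And>b. b \<in> B \<Longrightarrow> norm b = 1" "span B = UNIV"
    and nX: "nuclear_norm X = (\<Sum>b\<in>B. norm (X *v b))"
    by (rule nuclear_norm_orthonormal_basis[of X]) blast
  have Parseval: "(norm x)\<^sup>2 = (\<Sum>b\<in>B. (x \<bullet> b)\<^sup>2)" for x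
  proof -
    have "(norm (\<Sum>b\<in>B. (x \<bullet> b) *\<^sub>R b))\<^sup>2 = (\<Sum>b\<in>B. (norm ((x \<bullet> b) *\<^sub>R b))\<^sup>2)"
      by (rule norm_sum_Pythagorean) (use B in \<open>auto simp: pairwise_def orthogonal_def\<close>)
    then show ?thesis
      using orthonormal_basis_expand[of B x] B by simp
  qed
  have norm_vec: "(norm x)\<^sup>2 = (\<Sum>i\<in>UNIV. (norm (x $ i))\<^sup>2)" for x :: "'c::real_inner^'n1"
    by (simp add: power2_norm_eq_inner inner_vec_def)
  have "(norm X)\<^sup>2 = (\<Sum>i\<in>UNIV. \<Sum>b\<in>B. (X $ i \<bullet> b)\<^sup>2)"
    by (simp add: norm_vec Parseval)
  also have "\<dots> = (\<Sum>b\<in>B. \<Sum>i\<in>UNIV. (X $ i \<bullet> b)\<^sup>2)"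
    by (rule sum.swap)
  also have "\<dots> = (\<Sum>b\<in>B. (norm (X *v b))\<^sup>2)"
    by (simp add: norm_vec matrix_mult_dot)
  finally have "norm X = L2_set (\<lambda>b. norm (X *v b)) B"
    by (simp add: L2_set_def real_sqrt_unique)
  also have "\<dots> \<le> (\<Sum>b\<in>B. norm (X *v b))"
    by (rule L2_set_le_sum) simp
  finally show ?thesis by (simp add: nX)
qed

section \<open>Minimisers of a convex function with quadratic regularisation\<close>

lemma closed_lower_level_set:
  assumes "lower_semicontinuous f"
  shows "closed {x. f x \<le> c}"
proof -
  have "open {x. c < f x}"
  proof (rule open_subopen[THEN iffD2], rule ballI)
    fix x
    assume "x \<in> {x. c < f x}"
    then have "\<forall>\<^sub>F y in nhds x. c < f y"
      using assms by (simp add: lower_semicontinuous_def)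
    then obtain T where "open T" "x \<in> T" "\<forall>y\<in>T. c < f y"
      by (auto simp: eventually_nhds)
    then show "\<exists>T. open T \<and> x \<in> T \<and> T \<subseteq> {x. c < f x}"
      by (intro exI[of _ T]) auto
  qed
  moreover have "- {x. f x \<le> c} = {x. c < f x}"
    by auto
  ultimately show ?thesis
    by (simp add: closed_def)
qed

lemma convex_lower_level_set:
  assumes "convex_on S f"
  shows "convex {x \<in> S. f x \<le> c}"
proof (rule convexI)
  fix x y and u v :: real
  assume *: "x \<in> {x \<in> S. f x \<le> c}" "y \<in> {x \<in> S. f x \<le> c}" "0 \<le> u" "0 \<le> v" "u + v = 1"
  then have "f (u *\<^sub>R x + v *\<^sub>R y) \<le> u * f x + v * f y"
    using assms by (auto simp: convex_on_def)
  also have "\<dots> \<le> c"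
    using * by (intro convex_bound_le) auto
  finally show "u *\<^sub>R x + v *\<^sub>R y \<in> {x \<in> S. f x \<le> c}"
    using * assms by (auto simp: convex_on_def convex_def)
qed

lemma coercive_attains_inf:
  fixes g :: "'a::euclidean_space \<Rightarrow> real"
  assumes "closed S" "x0 \<in> S" "continuous_on UNIV g"
    and bd: "\<And>x. x \<in> S \<Longrightarrow> g x \<le> g x0 \<Longrightarrow> norm x \<le> R"
  obtains x where "x \<in> S" "\<And>y. y \<in> S \<Longrightarrow> g x \<le> g y"
proof -
  have x0: "x0 \<in> S \<inter> cball 0 R"
    using bd[of x0] \<open>x0 \<in> S\<close> by simp
  have "compact (S \<inter> cball 0 R)"
    using \<open>closed S\<close> by (simp add: closed_Int_compact)
  moreover have "continuous_on (S \<inter> cball 0 R) g"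
    using assms(3) by (rule continuous_on_subset) simp
  ultimately obtain x where x: "x \<in> S \<inter> cball 0 R" "\<And>y. y \<in> S \<inter> cball 0 R \<Longrightarrow> g x \<le> g y"
    using continuous_attains_inf[of "S \<inter> cball 0 R" g] x0 by blast
  have "g x \<le> g y" if "y \<in> S" for y
  proof (cases "g y \<le> g x0")
    case True
    then show ?thesis using x(2) bd that by simp
  next
    case False
    then show ?thesis using x(2)[OF x0] by simp
  qed
  then show ?thesis using that x(1) by blast
qed

text \<open>Two distinct minimisers are impossible since, by the parallelogram law, the objective at their
  midpoint would be smaller by at least \<open>c/4\<close> times their squared distance.\<close>

lemma ex1_arg_min_regularized:
  fixes g :: "'a::euclidean_space \<Rightarrow> real"
  assumes S: "closed S" "convex S" "S \<noteq> {}" and "0 < c"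
    and g: "convex_on UNIV g" "\<And>x. 0 \<le> g x"
  shows "\<exists>!x. is_arg_min (\<lambda>x. g x + c * (norm x)\<^sup>2) (\<lambda>x. x \<in> S) x"
proof -
  define h where "h = (\<lambda>x. g x + c * (norm x)\<^sup>2)"
  obtain x0 where x0: "x0 \<in> S" using S by blast
  have cont: "continuous_on UNIV h"
    unfolding h_def by (intro continuous_intros convex_on_continuous g) simp
  have bd: "norm x \<le> sqrt (h x0 / c)" if "h x \<le> h x0" for x
  proof (rule real_le_rsqrt)
    have "c * (norm x)\<^sup>2 \<le> h x0"
      using that g(2)[of x] by (simp add: h_def)
    then show "(norm x)\<^sup>2 \<le> h x0 / c"
      using \<open>0 < c\<close> by (simp add: pos_le_divide_eq mult.commute)
  qed
  obtain x where "x \<in> S" "\<And>y. y \<in> S \<Longrightarrow> h x \<le> h y"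
    using coercive_attains_inf[OF S(1) x0 cont bd] by blast
  then have ex: "is_arg_min h (\<lambda>x. x \<in> S) x"
    by (simp add: is_arg_min_linorder)
  have uniq: "x = y"
    if "is_arg_min h (\<lambda>x. x \<in> S) x" "is_arg_min h (\<lambda>x. x \<in> S) y" for x y
  proof (rule ccontr)
    assume "x \<noteq> y"
    have xS: "x \<in> S" and yS: "y \<in> S"
      and min: "\<And>z. z \<in> S \<Longrightarrow> h x \<le> h z" and "\<And>z. z \<in> S \<Longrightarrow> h y \<le> h z"
      using that by (simp_all add: is_arg_min_linorder)
    then have eq: "h x = h y"
      by (simp add: order.antisym)
    define z where "z = (1/2) *\<^sub>R x + (1/2) *\<^sub>R y"
    have "z \<in> S"
      unfolding z_def by (rule convexD[OF S(2) xS yS]) auto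
    have gz: "g z \<le> (g x + g y) / 2"
      using convex_onD[OF g(1), of "1/2" x y] by (simp add: z_def)
    have nz: "(norm z)\<^sup>2 = ((norm x)\<^sup>2 + (norm y)\<^sup>2) / 2 - (norm (x - y))\<^sup>2 / 4"
      by (simp add: z_def power2_norm_eq_inner inner_simps inner_commute field_simps)
    define d where "d = c * (norm (x - y))\<^sup>2"
    have "h z \<le> (h x + h y) / 2 - d / 4"
      using gz unfolding h_def nz d_def by (simp add: field_simps)
    moreover have "0 < d"
      using \<open>0 < c\<close> \<open>x \<noteq> y\<close> by (simp add: d_def)
    ultimately show False
      using min[OF \<open>z \<in> S\<close>] eq by (simp add: field_simps)
  qed
  show ?thesis using ex uniq unfolding h_def by blast
qed

text \<open>Comparison with \<open>p\<close> bounds the norm of \<open>x \<tau>\<close> by that of \<open>p\<close>. A gap \<open>\<delta>\<close> between \<open>g p\<close> and the values of \<open>g\<close> on the compact set \<open>K\<close> costs \<open>\<tau> \<delta>\<close>, and the norm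
  term can save at most \<open>1/2 \<parallel>p\<parallel>\<^sup>2\<close>.\<close>

lemma tendsto_regularized_minimizer:
  fixes g :: "'a::euclidean_space \<Rightarrow> real"
  assumes "closed S" "continuous_on UNIV g" "p \<in> S"
    and pmin: "\<And>y. y \<in> S \<Longrightarrow> g p \<le> g y"
    and puniq: "\<And>y. y \<in> S \<Longrightarrow> g y \<le> g p \<Longrightarrow> norm y \<le> norm p \<Longrightarrow> y = p"
    and x: "\<And>\<tau>. 0 < \<tau> \<Longrightarrow> x \<tau> \<in> S"
      "\<And>\<tau>. 0 < \<tau> \<Longrightarrow> \<tau> * g (x \<tau>) + 1/2 * (norm (x \<tau>))\<^sup>2 \<le> \<tau> * g p + 1/2 * (norm p)\<^sup>2"
  shows "(x \<longlongrightarrow> p) at_top"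
proof (rule tendstoI)
  fix \<epsilon> :: real
  assume "0 < \<epsilon>"
  define K where "K = S \<inter> cball 0 (norm p) - ball p \<epsilon>"
  have "compact K"
    unfolding K_def using \<open>closed S\<close> by (intro compact_diff closed_Int_compact) auto
  have xK: "x \<tau> \<in> K" if "0 < \<tau>" "\<not> dist (x \<tau>) p < \<epsilon>" for \<tau>
  proof -
    have "\<tau> * g p \<le> \<tau> * g (x \<tau>)"
      using pmin x(1) that by simp
    then have "(norm (x \<tau>))\<^sup>2 \<le> (norm p)\<^sup>2"
      using x(2)[OF that(1)] by linarith
    then have "norm (x \<tau>) \<le> norm p"
      by (rule power2_le_imp_le) simp
    then show ?thesis
      using x(1) that by (simp add: K_def dist_commute)
  qed
  show "\<forall>\<^sub>F \<tau> in at_top. dist (x \<tau>) p < \<epsilon>"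
  proof (cases "K = {}")
    case True
    have "\<forall>\<^sub>F \<tau>::real in at_top. 0 < \<tau>" by (rule eventually_gt_at_top)
    then show ?thesis
      by eventually_elim (use xK True in blast)
  next
    case False
    moreover have "continuous_on K g"
      using assms(2) by (rule continuous_on_subset) simp
    ultimately obtain z where z: "z \<in> K" "\<And>y. y \<in> K \<Longrightarrow> g z \<le> g y"
      using continuous_attains_inf[OF \<open>compact K\<close>] by blast
    define \<delta> where "\<delta> = g z - g p"
    have "0 < \<delta>"
    proof (rule ccontr)
      assume "\<not> 0 < \<delta>"
      then have "z = p"
        using z(1) by (intro puniq) (auto simp: K_def \<delta>_def)
      then show False
        using z(1) \<open>0 < \<epsilon>\<close> by (simp add: K_def)
    qed
    have "\<forall>\<^sub>F \<tau> in at_top. max 0 ((norm p)\<^sup>2 / \<delta>) < \<tau>" by (rule eventually_gt_at_top)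
    then show ?thesis
    proof eventually_elim
      case (elim \<tau>)
      then have "0 < \<tau>" by simp
      have large: "(norm p)\<^sup>2 < \<tau> * \<delta>"
        using elim \<open>0 < \<delta>\<close> by (simp add: pos_divide_less_eq)
      show ?case
      proof (rule ccontr)
        assume "\<not> dist (x \<tau>) p < \<epsilon>"
        then have "\<delta> \<le> g (x \<tau>) - g p"
          using z(2) xK \<open>0 < \<tau>\<close> by (simp add: \<delta>_def)
        then have "\<tau> * \<delta> \<le> \<tau> * (g (x \<tau>) - g p)"
          using \<open>0 < \<tau>\<close> by simp
        also have "\<dots> \<le> 1/2 * (norm p)\<^sup>2 - 1/2 * (norm (x \<tau>))\<^sup>2"
          using x(2)[OF \<open>0 < \<tau>\<close>] by (simp add: right_diff_distrib)
        also have "\<dots> \<le> (norm p)\<^sup>2"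
          using zero_le_power2[of "norm p"] zero_le_power2[of "norm (x \<tau>)"] by linarith
        finally show False using large by simp
      qed
    qed
  qed
qed

section \<open>Convergence of the regularised solutions\<close>

theorem theorem3p1:
  fixes f :: "nat \<Rightarrow> real^'n2^'n1 \<Rightarrow> real" and m :: nat
  assumes "\<And>i. i \<in> {1..m} \<Longrightarrow> convex_on UNIV (f i)"
    and "\<And>i. i \<in> {1..m} \<Longrightarrow> lower_semicontinuous (f i)"
    and "feasible m f \<noteq> {}"
  shows "(\<forall>\<tau>>0. \<exists>!X. is_arg_min (prox_objective \<tau>) (\<lambda>Y. Y \<in> feasible m f) X)
    \<and> (\<exists>!X. is_arg_min (\<lambda>Y. (norm Y)\<^sup>2) (nuclear_solution m f) X)
    \<and> ((\<lambda>\<tau>. norm (arg_min (prox_objective \<tau>) (\<lambda>Y. Y \<in> feasible m f)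
                    - arg_min (\<lambda>Y. (norm Y)\<^sup>2) (nuclear_solution m f))) \<longlongrightarrow> 0) at_top"
proof -
  let ?S = "feasible m f"
  have S_eq: "?S = (\<Inter>i\<in>{1..m}. {X. f i X \<le> 0})"
    by (auto simp: feasible_def)
  have closed: "closed ?S"
    unfolding S_eq using assms(2) by (intro closed_INT ballI closed_lower_level_set)
  have convex: "convex ?S"
    unfolding S_eq using convex_lower_level_set[OF assms(1)] by (intro convex_INT) simp
  have nn: "0 \<le> nuclear_norm X" for X :: "real^'n2^'n1"
    using norm_le_nuclear_norm[of X] norm_ge_zero[of X] by linarith

  have ex_prox: "\<exists>!X. is_arg_min (prox_objective \<tau>) (\<lambda>Y. Y \<in> ?S) X" if "0 < \<tau>" for \<tau>
  proof -
    have "convex_on UNIV (\<lambda>X::real^'n2^'n1. \<tau> * nuclear_norm X)"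
      using that convex_on_nuclear_norm by (intro convex_on_cmul) auto
    from ex1_arg_min_regularized[OF closed convex assms(3) _ this, of "1/2"] show ?thesis
      using that nn by (simp add: prox_objective_def[abs_def])
  qed

  obtain X0 where X0: "X0 \<in> ?S" using assms(3) by blast
  obtain X1 where X1: "X1 \<in> ?S" "\<And>Y. Y \<in> ?S \<Longrightarrow> nuclear_norm X1 \<le> nuclear_norm Y"
    using coercive_attains_inf[OF closed X0 continuous_on_nuclear_norm
        order_trans[OF norm_le_nuclear_norm]] by blast
  \<comment> \<open>As a sublevel set the solution set is closed and convex, so it has a unique point of least norm;
    this is the regularised problem with \<open>g = 0\<close>.\<close>
  let ?T = "?S \<inter> {X. nuclear_norm X \<le> nuclear_norm X1}"
  have sol: "nuclear_solution m f = (\<lambda>X. X \<in> ?T)"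
  proof
    fix X
    show "nuclear_solution m f X \<longleftrightarrow> X \<in> ?T"
      unfolding nuclear_solution_def is_arg_min_linorder
      using X1 order_trans[of "nuclear_norm X" "nuclear_norm X1"] by blast
  qed
  have "closed {X::real^'n2^'n1. nuclear_norm X \<le> nuclear_norm X1}"
    by (intro closed_Collect_le continuous_on_nuclear_norm continuous_on_const)
  then have "closed ?T"
    using closed by (rule closed_Int[rotated])
  moreover have "convex ?T"
    using convex_lower_level_set[OF convex_on_nuclear_norm] convex by (intro convex_Int) simp_all
  moreover have "?T \<noteq> {}" using X1(1) by blast
  ultimately have ex_inf: "\<exists>!X. is_arg_min (\<lambda>Y. (norm Y)\<^sup>2) (nuclear_solution m f) X"
    using ex1_arg_min_regularized[of ?T 1 "\<lambda>_. 0"] by (simp add: sol convex_on_const)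

  define P where "P = arg_min (\<lambda>Y. (norm Y)\<^sup>2) (nuclear_solution m f)"
  define Xs where "Xs = (\<lambda>\<tau>. arg_min (prox_objective \<tau>) (\<lambda>Y. Y \<in> ?S))"
  have P: "is_arg_min (\<lambda>Y. (norm Y)\<^sup>2) (nuclear_solution m f) P"
    unfolding P_def arg_min_def using ex_inf by (metis someI_ex)
  have Xs: "is_arg_min (prox_objective \<tau>) (\<lambda>Y. Y \<in> ?S) (Xs \<tau>)" if "0 < \<tau>" for \<tau>
    unfolding Xs_def arg_min_def using ex_prox[OF that] by (metis someI_ex)
  have PS: "P \<in> ?S" "nuclear_norm P \<le> nuclear_norm X1"
    using P by (auto simp: is_arg_min_linorder sol)
  have "(Xs \<longlongrightarrow> P) at_top"
  proof (rule tendsto_regularized_minimizer[OF closed continuous_on_nuclear_norm PS(1)])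
    show "nuclear_norm P \<le> nuclear_norm Y" if "Y \<in> ?S" for Y
      using PS(2) X1(2)[OF that] by simp
    show "Y = P" if "Y \<in> ?S" "nuclear_norm Y \<le> nuclear_norm P" "norm Y \<le> norm P" for Y
    proof -
      have "nuclear_solution m f Y"
        using that PS(2) by (simp add: sol)
      then have "is_arg_min (\<lambda>Y. (norm Y)\<^sup>2) (nuclear_solution m f) Y"
        using is_arg_min_antimono[OF P] that(3) by (simp add: power_mono)
      then show ?thesis using ex_inf P by blast
    qed
    show "Xs \<tau> \<in> ?S" if "0 < \<tau>" for \<tau>
      using Xs[OF that] by (simp add: is_arg_min_linorder)
    show "\<tau> * nuclear_norm (Xs \<tau>) + 1/2 * (norm (Xs \<tau>))\<^sup>2 \<le> \<tau> * nuclear_norm P + 1/2 * (norm P)\<^sup>2"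
      if "0 < \<tau>" for \<tau>
      using Xs[OF that] PS(1) by (simp add: is_arg_min_linorder prox_objective_def)
  qed
  then have "((\<lambda>\<tau>. norm (Xs \<tau> - P)) \<longlongrightarrow> 0) at_top"
    by (simp add: LIM_zero tendsto_norm_zero)
  then show ?thesis
    using ex_prox ex_inf by (simp add: Xs_def P_def)
qed

end
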